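(* Let $n\ge1$ and let $\omega_1,\dots,\omega_n$ be distinct complex numbers. Let $S=\{\alpha_1,\dots,\alpha_s\}$ be a finite subset of $\mathbb{C}$ of cardinality $s\ge1$. Then for any $n$-tuple of non-zero polynomials $\mathbf{a}=(a_1(T),\dots,a_n(T))$ in $\mathbb{C}[T]$ we have \[ |a_1|_\infty\cdots|a_n|_\infty\prod_{j=1}^s\Big(\|\mathbf{a}\|_{\alpha_j}^{-1}|a_1|_{\alpha_j}\cdots|a_n|_{\alpha_j}|\mathbf{a}\cdot\mathbf{f}|_{\alpha_j}\Big)\ge C(n)^{-s}, \] where $\mathbf{f}=(e^{\omega_1T},\dots,e^{\omega_nT})$ and $C(n)=\exp(n(n-1)/2)$.
   Context: For $\alpha\in\mathbb{C}$, let $K_\alpha=\mathbb{C}((T-\alpha))$ with absolute value $|f|_\alpha=e^{-\mathrm{ord}_\alpha(f)}$, where $\mathrm{ord}_\alpha$ is the order at $\alpha$ ($\mathrm{ord}_\alpha(0)=\infty$), and for polynomials $|f|_\infty=e^{\deg f}$. For $\omega,\alpha\in\mathbb{C}$, $e^{\omega T}$ is viewed in $\mathbb{C}[[T-\alpha]]$ as $e^{\omega\alpha}\sum_{j\ge0}\frac{\omega^j}{j!}(T-\alpha)^j$. On $K_\alpha^n$, $\|\mathbf{x}\|_\alpha=\max_i|x_i|_\alpha$, and $\mathbf{a}\cdot\mathbf{f}=\sum_ia_if_i$. *)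

theory Defs
  imports Complex_Main
    "HOL-Computational_Algebra.Formal_Laurent_Series"
    "HOL-Computational_Algebra.Polynomial_FPS"
begin

(* For every alpha the field C((T - alpha)) is represented by the type
   "complex fls", whose formal variable plays the role of the local parameter
   T - alpha. The point alpha enters only through the embeddings poly_at and
   exp_at below. *)

(* fls_subdegree is 0 at the zero series, hence the case distinction
   (ord 0 = infinity, so the absolute value of 0 is 0). *)
definition fls_abs :: "complex fls \<Rightarrow> real" where
  "fls_abs f = (if f = 0 then 0 else exp (- real_of_int (fls_subdegree f)))"

definition poly_abs_infty :: "complex poly \<Rightarrow> real" where
  "poly_abs_infty p = (if p = 0 then 0 else exp (real (degree p)))"

(* Taylor expansion at alpha: substitute T = alpha + X with X = T - alpha. *)
definition poly_at :: "complex \<Rightarrow> complex poly \<Rightarrow> complex fls" where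
  "poly_at \<alpha> p = fps_to_fls (fps_of_poly (pcompose p [:\<alpha>, 1:]))"

definition exp_at :: "complex \<Rightarrow> complex \<Rightarrow> complex fls" where
  "exp_at \<alpha> \<omega> = fps_to_fls (fps_const (exp (\<omega> * \<alpha>)) * Abs_fps (\<lambda>j. \<omega> ^ j / fact j))"

(* Vectors of length n are functions on nat, read at the indices 1, ..., n;
   meaningful only for n > 0. *)
definition vec_norm :: "nat \<Rightarrow> (nat \<Rightarrow> complex fls) \<Rightarrow> real" where
  "vec_norm n x = Max ((\<lambda>i. fls_abs (x i)) ` {1..n})"

definition vec_dot :: "nat \<Rightarrow> (nat \<Rightarrow> complex fls) \<Rightarrow> (nat \<Rightarrow> complex fls) \<Rightarrow> complex fls" where
  "vec_dot n x y = (\<Sum>i=1..n. x i * y i)"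

definition C_const :: "nat \<Rightarrow> real" where
  "C_const n = exp (real n * (real n - 1) / 2)"

end

(* The Wronskian of the functions a_j e^(w_j T) is D e^((w_1 + ... + w_n) T), where the
   polynomial D has the entries (d/dT + w_j)^i a_j. The coefficient of D in degree
   deg a_1 + ... + deg a_n is the product of the leading coefficients times the Vandermonde
   determinant of the w_j, hence nonzero, so D has exactly this degree. At a point alpha, replace
   the column of an a_k of minimal order by the sum L of all columns: since the i-th derivative
   lowers orders by at most i, D vanishes at alpha to order at least
   (sum of ord a_j over j ~= k) + ord L - n (n - 1) / 2. The claim follows because the orders
   of D at the points of S add up to at most deg D. *)
theory Submission
  imports Defs "Jordan_Normal_Form.Determinant"
begin

section \<open>Orders of vanishing of Wronskians of power series\<close>

text \<open>In the Leibniz expansion the term of \<open>p\<close> is divisible by \<open>x\<close>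
  to the power of the sum of the \<open>e j - p j\<close>. Truncated subtraction only enlarges this
  exponent, and the \<open>p j\<close> add up to the sum of all \<open>i < n\<close>.\<close>

lemma dvd_det_if_graded:
  fixes x :: "'a :: comm_ring_1"
  assumes A: "A \<in> carrier_mat n n"
    and dvd: "\<And>i j. i < n \<Longrightarrow> j < n \<Longrightarrow> x ^ (e j - i) dvd A $$ (i, j)"
  shows "x ^ ((\<Sum>j<n. e j) - (\<Sum>i<n. i)) dvd det A"
  unfolding det_col[OF A]
proof (rule dvd_sum, rule dvd_mult)
  fix p assume "p \<in> {p. p permutes {0..<n}}"
  then have p: "p permutes {..<n}" by (simp add: lessThan_atLeast0)
  have lt: "p j < n" if "j < n" for j
    using permutes_in_image[OF p, of j] that by simp
  have "(\<Sum>j<n. e j) \<le> (\<Sum>j<n. (e j - p j) + p j)"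
    by (rule sum_mono) simp
  also have "\<dots> = (\<Sum>j<n. e j - p j) + (\<Sum>i<n. i)"
    using sum.permute[OF p, of "\<lambda>i. i"] by (simp add: sum.distrib o_def)
  finally have "x ^ ((\<Sum>j<n. e j) - (\<Sum>i<n. i)) dvd x ^ (\<Sum>j<n. e j - p j)"
    by (intro le_imp_power_dvd) simp
  also have "\<dots> = (\<Prod>j<n. x ^ (e j - p j))"
    by (simp add: power_sum)
  also have "\<dots> dvd (\<Prod>j<n. A $$ (p j, j))"
    by (rule prod_dvd_prod) (auto intro: dvd lt)
  finally show "x ^ ((\<Sum>j<n. e j) - (\<Sum>i<n. i)) dvd (\<Prod>j<n. A $$ (p j, j))" .
qed

text \<open>Each derivative costs at most one power of X. Divisibility is used instead of
  \<open>subdegree\<close> because it also treats the zero series correctly, whose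
  \<open>subdegree\<close> is 0.\<close>

lemma fps_X_power_dvd_higher_deriv:
  fixes f :: "'a :: field fps"
  assumes "fps_X ^ m dvd f"
  shows "fps_X ^ (m - i) dvd (fps_deriv ^^ i) f"
proof (induction i)
  case 0
  then show ?case using assms by simp
next
  case (Suc i)
  define g where "g = (fps_deriv ^^ i) f"
  have "g $ l = 0" if "l < m - i" for l
    using Suc that unfolding g_def by (auto simp: fps_X_power_mult_nth)
  then have "fps_deriv g $ l = 0" if "l < m - Suc i" for l
    using that by simp
  then have "fps_deriv g = fps_X ^ (m - Suc i) * fps_shift (m - Suc i) (fps_deriv g)"
    by (auto simp: fps_eq_iff fps_X_power_mult_nth)
  then show ?case by (simp add: g_def dvd_def) blast
qed

lemma fps_X_power_subdegree_dvd:
  fixes f :: "'a :: field fps"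
  shows "fps_X ^ subdegree f dvd f"
proof -
  have "f = fps_X ^ subdegree f * fps_shift (subdegree f) f"
    by (auto simp: fps_eq_iff fps_X_power_mult_nth)
  then show ?thesis by (rule dvdI)
qed

lemma higher_fps_deriv_sum:
  "(fps_deriv ^^ i) (sum f A) = (\<Sum>j\<in>A. (fps_deriv ^^ i) (f j))"
  by (induction i) (simp_all add: fps_deriv_sum)

definition fps_wronskian :: "nat \<Rightarrow> (nat \<Rightarrow> 'a :: comm_ring_1 fps) \<Rightarrow> 'a fps" where
  "fps_wronskian n f = det (mat n n (\<lambda>(i, j). (fps_deriv ^^ i) (f j)))"

text \<open>Multiplying the Wronskian matrix by the all-ones vector adds up its columns, so Cramer's
  rule gives the factor \<open>u $ k = 1\<close>.\<close>

lemma fps_wronskian_replace_sum: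
  assumes "k < n"
  shows "fps_wronskian n f = fps_wronskian n (f(k := \<Sum>j<n. f j))"
proof -
  define W where "W = mat n n (\<lambda>(i, j). (fps_deriv ^^ i) (f j))"
  define u where "u = vec n (\<lambda>_. 1 :: 'a fps)"
  have "replace_col W (W *\<^sub>v u) k
      = mat n n (\<lambda>(i, j). (fps_deriv ^^ i) ((f(k := \<Sum>j<n. f j)) j))"
    by (intro eq_matI)
       (auto simp: replace_col_def W_def u_def scalar_prod_def higher_fps_deriv_sum
          lessThan_atLeast0)
  moreover have "det (replace_col W (W *\<^sub>v u) k) = u $ k * det W"
    by (rule cramer_lemma_mat) (use assms in \<open>auto simp: W_def u_def\<close>)
  ultimately show ?thesis
    using assms by (simp add: fps_wronskian_def W_def u_def)
qed

text \<open>Once column \<open>k\<close> holds the derivatives of the full sum, the graded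
  divisibility of the determinant bounds the orders of all columns together.\<close>

lemma subdegree_sum_le_fps_wronskian:
  fixes f :: "nat \<Rightarrow> 'a :: field fps"
  assumes "k < n" and nz: "fps_wronskian n f \<noteq> 0"
  shows "(\<Sum>j<n. f j) \<noteq> 0"
    and "(\<Sum>j\<in>{..<n} - {k}. subdegree (f j)) + subdegree (\<Sum>j<n. f j)
      \<le> subdegree (fps_wronskian n f) + (\<Sum>i<n. i)"
proof -
  define g where "g = f(k := \<Sum>j<n. f j)"
  have W: "fps_wronskian n f = fps_wronskian n g"
    unfolding g_def by (rule fps_wronskian_replace_sum[OF assms(1)])
  have dvd: "fps_X ^ ((\<Sum>j<n. e j) - (\<Sum>i<n. i)) dvd fps_wronskian n g"
    if "\<And>j. fps_X ^ e j dvd g j" for e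
    unfolding fps_wronskian_def
    by (rule dvd_det_if_graded) (auto intro: fps_X_power_dvd_higher_deriv that)
  have le: "(\<Sum>j<n. e j) \<le> subdegree (fps_wronskian n f) + (\<Sum>i<n. i)"
    if "\<And>j. fps_X ^ e j dvd g j" for e
  proof -
    from dvd_imp_subdegree_le[OF dvd[of e]] that nz
    show ?thesis by (simp add: W fps_X_power_subdegree)
  qed
  show "(\<Sum>j<n. f j) \<noteq> 0"
  proof
    \<comment> \<open>A zero column is divisible by every power of X; an exponent one above the
      bound in \<open>le\<close> gives the contradiction.\<close>
    assume "(\<Sum>j<n. f j) = 0"
    then have "fps_X ^ (if j = k then Suc (subdegree (fps_wronskian n f) + (\<Sum>i<n. i)) else 0) dvd g j"
      for j by (simp add: g_def)
    from le[OF this] assms(1) show False by simp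
  qed
  have "(\<Sum>j<n. subdegree (g j)) = subdegree (g k) + (\<Sum>j\<in>{..<n} - {k}. subdegree (g j))"
    using assms(1) by (intro sum.remove) auto
  also have "(\<Sum>j\<in>{..<n} - {k}. subdegree (g j)) = (\<Sum>j\<in>{..<n} - {k}. subdegree (f j))"
    by (intro sum.cong) (auto simp: g_def)
  finally show "(\<Sum>j\<in>{..<n} - {k}. subdegree (f j)) + subdegree (\<Sum>j<n. f j)
      \<le> subdegree (fps_wronskian n f) + (\<Sum>i<n. i)"
    using le[of "\<lambda>j. subdegree (g j)", OF fps_X_power_subdegree_dvd] by (simp add: g_def)
qed

section \<open>The polynomial factor of the Wronskian and its degree\<close>

text \<open>This is d/dT conjugated by e^(wT): the derivative of p e^(wT) is
  \<open>exp_deriv w p\<close> times e^(wT).\<close>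

definition exp_deriv :: "'a \<Rightarrow> 'a :: idom poly \<Rightarrow> 'a poly" where
  "exp_deriv w p = pderiv p + Polynomial.smult w p"

definition exp_wronskian :: "nat \<Rightarrow> (nat \<Rightarrow> 'a :: idom) \<Rightarrow> (nat \<Rightarrow> 'a poly) \<Rightarrow> 'a poly" where
  "exp_wronskian n w a = det (mat n n (\<lambda>(i, j). (exp_deriv (w j) ^^ i) (a j)))"

lemma degree_higher_exp_deriv_le: "degree ((exp_deriv w ^^ i) p) \<le> degree p"
proof (induction i)
  case (Suc i)
  then show ?case
    by (auto intro!: degree_le simp: exp_deriv_def coeff_pderiv coeff_eq_0)
qed simp

text \<open>\<open>pderiv\<close> contributes nothing in the top degree, so each step multiplies
  that coefficient by \<open>w\<close>. The coefficient is read at \<open>degree p\<close>, since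
  the degree of the iterate can drop when \<open>w = 0\<close>.\<close>

lemma coeff_higher_exp_deriv:
  "coeff ((exp_deriv w ^^ i) p) (degree p) = w ^ i * lead_coeff p"
proof (induction i)
  case (Suc i)
  define q where "q = (exp_deriv w ^^ i) p"
  have "coeff q (Suc (degree p)) = 0"
    using degree_higher_exp_deriv_le[of i w p] by (intro coeff_eq_0) (simp add: q_def)
  moreover have "(exp_deriv w ^^ Suc i) p = pderiv q + Polynomial.smult w q"
    by (simp add: q_def exp_deriv_def[of w])
  ultimately show ?case using Suc by (simp add: q_def coeff_pderiv)
qed simp

text \<open>Upper bounds \<open>d j\<close> replace exact degrees because the matrix entries may
  have smaller degree than their column's polynomial.\<close>

lemma coeff_prod_sum_degree_bound:
  assumes "finite A" and "\<And>j. j \<in> A \<Longrightarrow> degree (f j) \<le> d j"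
  shows "degree (prod f A) \<le> sum d A \<and> coeff (prod f A) (sum d A) = (\<Prod>j\<in>A. coeff (f j) (d j))"
  using assms
proof (induction A rule: finite_induct)
  case (insert x A)
  then have le: "degree (f x) \<le> d x" "degree (prod f A) \<le> sum d A" by auto
  have "degree (f x * prod f A) \<le> d x + sum d A"
    using degree_mult_le[of "f x" "prod f A"] le by linarith
  moreover have "coeff (f x * prod f A) (d x + sum d A) = coeff (f x) (d x) * coeff (prod f A) (sum d A)"
  proof -
    \<comment> \<open>For \<open>i > d x\<close> the first factor vanishes, for
      \<open>i < d x\<close> the second, as its index exceeds \<open>sum d A\<close>.\<close>
    have "coeff (f x) i * coeff (prod f A) (d x + sum d A - i) = 0" if "i \<noteq> d x" for i
      using le that by (cases "i < d x") (auto simp: coeff_eq_0)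
    then have "coeff (f x * prod f A) (d x + sum d A)
        = (\<Sum>i\<in>{d x}. coeff (f x) i * coeff (prod f A) (d x + sum d A - i))"
      unfolding coeff_mult by (intro sum.mono_neutral_right) auto
    then show ?thesis by simp
  qed
  ultimately show ?case using insert by simp
qed simp

text \<open>A kernel vector of the transpose would be the coefficient vector of a non-zero
  polynomial of degree below \<open>n\<close> with the \<open>n\<close> distinct roots
  \<open>w i\<close>.\<close>

lemma vandermonde_det_nonzero:
  fixes w :: "nat \<Rightarrow> 'a :: field"
  assumes inj: "inj_on w {..<n}"
  shows "det (mat n n (\<lambda>(i, j). w j ^ i)) \<noteq> 0"
proof
  define B where "B = mat n n (\<lambda>(i, j). w i ^ j)"
  assume "det (mat n n (\<lambda>(i, j). w j ^ i)) = 0"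
  moreover have "mat n n (\<lambda>(i, j). w j ^ i) = transpose_mat B"
    by (intro eq_matI) (auto simp: B_def)
  moreover have B: "B \<in> carrier_mat n n" by (simp add: B_def)
  ultimately have "det B = 0" by (simp add: det_transpose)
  then obtain v where v: "v \<in> carrier_vec n" "v \<noteq> 0\<^sub>v n" "B *\<^sub>v v = 0\<^sub>v n"
    using det_0_iff_vec_prod_zero_field[OF B] by blast
  define p where "p = (\<Sum>i<n. monom (v $ i) i)"
  have coeff: "coeff p i = (if i < n then v $ i else 0)" for i
    by (simp add: p_def coeff_sum)
  have "p \<noteq> 0"
  proof
    assume "p = 0"
    then have "v $ i = 0" if "i < n" for i using coeff[of i] that by simp
    then have "v = 0\<^sub>v n" using v(1) by (intro eq_vecI) auto
    with v(2) show False by simp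
  qed
  have root: "poly p (w i) = 0" if "i < n" for i
  proof -
    have "poly p (w i) = (B *\<^sub>v v) $ i"
      using that v(1)
      by (simp add: p_def poly_sum poly_monom B_def scalar_prod_def lessThan_atLeast0 mult.commute)
    with v(3) that show ?thesis by simp
  qed
  have "n = card (w ` {..<n})" using inj by (simp add: card_image)
  also have "\<dots> \<le> card {x. poly p x = 0}"
    using root poly_roots_finite[OF \<open>p \<noteq> 0\<close>] by (intro card_mono) auto
  also have "\<dots> \<le> degree p" by (rule card_poly_roots_bound[OF \<open>p \<noteq> 0\<close>])
  finally have "coeff p (degree p) = 0" by (simp add: coeff)
  with \<open>p \<noteq> 0\<close> show False by simp
qed

lemma degree_exp_wronskian:
  fixes w :: "nat \<Rightarrow> 'a :: field"
  assumes "inj_on w {..<n}" and nz: "\<And>j. j < n \<Longrightarrow> a j \<noteq> 0"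
  shows "exp_wronskian n w a \<noteq> 0" and "degree (exp_wronskian n w a) = (\<Sum>j<n. degree (a j))"
proof -
  define M where "M = mat n n (\<lambda>(i, j). (exp_deriv (w j) ^^ i) (a j))"
  define V where "V = mat n n (\<lambda>(i, j). w j ^ i)"
  define d where "d = (\<Sum>j<n. degree (a j))"
  have MC: "M \<in> carrier_mat n n" and VC: "V \<in> carrier_mat n n" by (simp_all add: M_def V_def)
  have pp: "degree (\<Prod>j<n. M $$ (p j, j)) \<le> d
      \<and> coeff (\<Prod>j<n. M $$ (p j, j)) d = (\<Prod>j<n. lead_coeff (a j)) * (\<Prod>j<n. V $$ (p j, j))"
    if "p permutes {0..<n}" for p
  proof -
    have lt: "p j < n" if "j < n" for j
      using permutes_in_image[OF \<open>p permutes {0..<n}\<close>, of j] that by simp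
    then show ?thesis
      using coeff_prod_sum_degree_bound[of "{..<n}" "\<lambda>j. M $$ (p j, j)" "\<lambda>j. degree (a j)"]
      by (auto simp: M_def V_def d_def degree_higher_exp_deriv_le coeff_higher_exp_deriv
          prod.distrib mult.commute)
  qed
  \<comment> \<open>With the sign as a scalar, degrees and coefficients of the Leibniz sum can be
    read off term by term.\<close>
  have sc: "signof p * q = Polynomial.smult (signof p) q" for p :: "nat \<Rightarrow> nat" and q :: "'a poly"
    by (simp add: sign_def)
  have le: "degree (det M) \<le> d"
    unfolding det_col[OF MC] sc
    by (intro degree_sum_le finite_permutations order_trans[OF degree_smult_le]) (use pp in auto)
  have "coeff (det M) d = (\<Prod>j<n. lead_coeff (a j)) * det V"
    unfolding det_col[OF MC] det_col[OF VC] sc coeff_sum sum_distrib_left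
    by (intro sum.cong) (use pp in auto)
  also have "\<dots> \<noteq> 0"
    using vandermonde_det_nonzero[OF assms(1)] nz by (simp add: V_def)
  finally have "coeff (det M) d \<noteq> 0" .
  with le le_degree[OF this] show "exp_wronskian n w a \<noteq> 0"
    and "degree (exp_wronskian n w a) = (\<Sum>j<n. degree (a j))"
    by (auto simp: exp_wronskian_def M_def d_def)
qed

section \<open>Taylor expansion and the local order of the Wronskian\<close>

text \<open>The power series underlying \<open>poly_at\<close>: staying in \<open>fps\<close> keeps
  orders natural numbers and divisibility by powers of X meaningful.\<close>

definition taylor :: "'a \<Rightarrow> 'a :: idom poly \<Rightarrow> 'a fps" where
  "taylor \<alpha> p = fps_of_poly (pcompose p [:\<alpha>, 1:])"

lemma taylor_simps:
  "taylor \<alpha> 0 = 0" "taylor \<alpha> 1 = 1" "taylor \<alpha> (p + q) = taylor \<alpha> p + taylor \<alpha> q"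
  "taylor \<alpha> (p * q) = taylor \<alpha> p * taylor \<alpha> q"
  "taylor \<alpha> (Polynomial.smult c p) = fps_const c * taylor \<alpha> p"
  by (simp_all add: taylor_def fps_of_poly_simps pcompose_1 pcompose_add pcompose_mult pcompose_smult)

lemma taylor_pderiv: "taylor \<alpha> (pderiv p) = fps_deriv (taylor \<alpha> p)"
  by (simp add: taylor_def pderiv_pcompose pderiv_pCons flip: fps_of_poly_pderiv)

lemma comm_ring_hom_taylor: "comm_ring_hom (taylor \<alpha>)"
  by unfold_locales (simp_all add: taylor_simps)

text \<open>The factor (T - \<alpha>)^m with m the order expands to X^m, and the cofactor
  \<open>q\<close> has constant term \<open>poly q \<alpha>\<close>, which is non-zero.\<close>

lemma subdegree_taylor:
  fixes p :: "'a :: field poly"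
  assumes "p \<noteq> 0"
  shows "taylor \<alpha> p \<noteq> 0" and "subdegree (taylor \<alpha> p) = order \<alpha> p"
proof -
  obtain q where q: "p = [:- \<alpha>, 1:] ^ order \<alpha> p * q" "\<not> [:- \<alpha>, 1:] dvd q"
    using order_decomp[OF assms] by blast
  interpret taylor: comm_ring_hom "taylor \<alpha> :: 'a poly \<Rightarrow> 'a fps" by (rule comm_ring_hom_taylor)
  have "taylor \<alpha> [:- \<alpha>, 1:] = fps_X"
    by (simp add: taylor_def pcompose_pCons)
  then have "taylor \<alpha> ([:- \<alpha>, 1:] ^ m) = fps_X ^ m" for m
    by (simp add: taylor.hom_power)
  then have t: "taylor \<alpha> p = fps_X ^ order \<alpha> p * taylor \<alpha> q"
    by (subst q(1)) (simp add: taylor_simps)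
  have "taylor \<alpha> q $ 0 = poly q \<alpha>"
    by (simp add: taylor_def poly_pcompose flip: poly_0_coeff_0)
  also have "\<dots> \<noteq> 0" using q(2) by (simp add: poly_eq_0_iff_dvd)
  finally have "taylor \<alpha> q $ 0 \<noteq> 0" .
  then have "taylor \<alpha> q \<noteq> 0" "subdegree (taylor \<alpha> q) = 0" by auto
  then show "taylor \<alpha> p \<noteq> 0" "subdegree (taylor \<alpha> p) = order \<alpha> p"
    by (simp_all add: t)
qed

text \<open>The constant \<open>c\<close> stands for the value e^(w \<alpha>) of the exponential at
  the expansion point, which has no meaning over a general field.\<close>

lemma higher_fps_deriv_taylor_exp:
  fixes p :: "'a :: field_char_0 poly"
  shows "(fps_deriv ^^ i) (taylor \<alpha> p * (fps_const c * fps_exp w))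
    = taylor \<alpha> ((exp_deriv w ^^ i) p) * (fps_const c * fps_exp w)"
  by (induction i) (simp_all add: exp_deriv_def[of w] taylor_simps taylor_pderiv algebra_simps)

text \<open>Every entry of column \<open>j\<close> contains the same exponential factor, so each
  Leibniz term contains the product of all of them.\<close>

lemma fps_wronskian_taylor_exp:
  fixes a :: "nat \<Rightarrow> 'a :: field_char_0 poly"
  shows "fps_wronskian n (\<lambda>j. taylor \<alpha> (a j) * (fps_const (c j) * fps_exp (w j)))
    = taylor \<alpha> (exp_wronskian n w a) * (\<Prod>j<n. fps_const (c j) * fps_exp (w j))"
proof -
  interpret taylor: comm_ring_hom "taylor \<alpha> :: 'a poly \<Rightarrow> 'a fps" by (rule comm_ring_hom_taylor)
  define E where "E = (\<lambda>j. fps_const (c j) * fps_exp (w j))"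
  define M where "M = mat n n (\<lambda>(i, j). (exp_deriv (w j) ^^ i) (a j))"
  define T where "T = map_mat (taylor \<alpha>) M"
  define W where "W = mat n n (\<lambda>(i, j). (fps_deriv ^^ i) (taylor \<alpha> (a j) * E j))"
  have TC: "T \<in> carrier_mat n n" and WC: "W \<in> carrier_mat n n"
    by (simp_all add: T_def M_def W_def)
  have "det W = det T * (\<Prod>j<n. E j)"
    unfolding det_col[OF WC] det_col[OF TC] sum_distrib_right
  proof (rule sum.cong[OF refl])
    fix p assume p: "p \<in> {p. p permutes {0..<n}}"
    have "p j < n" if "j < n" for j using permutes_in_image[of p "{0..<n}" j] p that by simp
    then have "(\<Prod>j<n. W $$ (p j, j)) = (\<Prod>j<n. T $$ (p j, j) * E j)"
      by (intro prod.cong)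
         (auto simp: W_def T_def M_def E_def higher_fps_deriv_taylor_exp)
    then show "signof p * (\<Prod>j<n. W $$ (p j, j)) = signof p * (\<Prod>j<n. T $$ (p j, j)) * (\<Prod>j<n. E j)"
      by (simp add: prod.distrib mult.assoc)
  qed
  then show ?thesis
    by (simp add: fps_wronskian_def exp_wronskian_def W_def T_def M_def E_def)
qed

text \<open>The exponential factors are units of the power series ring, so they change neither the
  orders of the columns nor that of the Wronskian.\<close>

lemma order_exp_wronskian_ge:
  fixes a :: "nat \<Rightarrow> 'a :: field_char_0 poly" and \<alpha> :: 'a
  assumes "inj_on w {..<n}" and nz: "\<And>j. j < n \<Longrightarrow> a j \<noteq> 0" and c: "\<And>j. c j \<noteq> 0" and "k < n"
  defines "L \<equiv> \<Sum>j<n. taylor \<alpha> (a j) * (fps_const (c j) * fps_exp (w j))"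
  shows "L \<noteq> 0"
    and "(\<Sum>j\<in>{..<n} - {k}. order \<alpha> (a j)) + subdegree L \<le> order \<alpha> (exp_wronskian n w a) + (\<Sum>i<n. i)"
proof -
  define E where "E = (\<lambda>j. fps_const (c j) * fps_exp (w j))"
  define f where "f = (\<lambda>j. taylor \<alpha> (a j) * E j)"
  have E: "E j \<noteq> 0" "subdegree (E j) = 0" for j
  proof -
    have "E j $ 0 \<noteq> 0" using c by (simp add: E_def)
    then show "E j \<noteq> 0" "subdegree (E j) = 0" by (auto simp: subdegree_eq_0)
  qed
  have PE: "(\<Prod>j<n. E j) \<noteq> 0" "subdegree (\<Prod>j<n. E j) = 0"
    using E by (auto simp: subdegree_prod)
  have W: "fps_wronskian n f = taylor \<alpha> (exp_wronskian n w a) * (\<Prod>j<n. E j)"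
    unfolding f_def E_def by (rule fps_wronskian_taylor_exp)
  note D = degree_exp_wronskian(1)[of w n a, OF assms(1) nz]
  have Wnz: "fps_wronskian n f \<noteq> 0"
    using subdegree_taylor(1)[OF D] PE(1) by (simp add: W)
  have Wsub: "subdegree (fps_wronskian n f) = order \<alpha> (exp_wronskian n w a)"
    using subdegree_taylor[OF D] PE by (simp add: W)
  have "subdegree (f j) = order \<alpha> (a j)" if "j < n" for j
    using subdegree_taylor[OF nz[OF that]] E by (simp add: f_def)
  then have "(\<Sum>j\<in>{..<n} - {k}. subdegree (f j)) = (\<Sum>j\<in>{..<n} - {k}. order \<alpha> (a j))"
    by simp
  with subdegree_sum_le_fps_wronskian[OF \<open>k < n\<close> Wnz] Wsub
  show "L \<noteq> 0" and "(\<Sum>j\<in>{..<n} - {k}. order \<alpha> (a j)) + subdegree L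
      \<le> order \<alpha> (exp_wronskian n w a) + (\<Sum>i<n. i)"
    by (simp_all add: L_def f_def E_def)
qed

section \<open>Absolute values: the local estimate and the product over S\<close>

lemma fps_to_fls_sum: "fps_to_fls (sum f A) = (\<Sum>x\<in>A. fps_to_fls (f x))"
  by (induction A rule: infinite_finite_induct) simp_all

lemma poly_at_conv_taylor: "poly_at \<alpha> p = fps_to_fls (taylor \<alpha> p)"
  by (simp add: poly_at_def taylor_def)

lemma exp_at_conv_fps_exp: "exp_at \<alpha> w = fps_to_fls (fps_const (exp (w * \<alpha>)) * fps_exp w)"
  by (simp add: exp_at_def fps_exp_def)

lemma fls_abs_fps_to_fls: "f \<noteq> 0 \<Longrightarrow> fls_abs (fps_to_fls f) = exp (- real (subdegree f))"
  by (simp add: fls_abs_def fls_subdegree_fls_to_fps)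

lemma fls_abs_poly_at: "p \<noteq> 0 \<Longrightarrow> fls_abs (poly_at \<alpha> p) = exp (- real (order \<alpha> p))"
  by (simp add: poly_at_conv_taylor fls_abs_fps_to_fls subdegree_taylor)

lemma inj_on_Suc_shift: "inj_on w {1..n} \<Longrightarrow> inj_on (\<lambda>j. w (Suc j)) {..<n}"
  by (rule inj_onI) (use inj_onD[of w "{1..n}" "Suc _" "Suc _"] in fastforce)

text \<open>This is the order estimate at one point, with signs reversed and exponentiated.\<close>

lemma local_factor_ge:
  fixes a :: "nat \<Rightarrow> complex poly"
  assumes "n \<ge> 1" and inj: "inj_on w {1..n}" and nz: "\<And>i. i \<in> {1..n} \<Longrightarrow> a i \<noteq> 0"
  shows "exp (- real (order \<alpha> (exp_wronskian n (\<lambda>j. w (Suc j)) (\<lambda>j. a (Suc j))))) * inverse (C_const n)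
    \<le> inverse (vec_norm n (\<lambda>i. poly_at \<alpha> (a i))) * (\<Prod>i=1..n. fls_abs (poly_at \<alpha> (a i))) *
      fls_abs (vec_dot n (\<lambda>i. poly_at \<alpha> (a i)) (\<lambda>i. exp_at \<alpha> (w i)))"
proof -
  define L where "L = (\<Sum>j<n. taylor \<alpha> (a (Suc j)) * (fps_const (exp (w (Suc j) * \<alpha>)) * fps_exp (w (Suc j))))"
  define D where "D = exp_wronskian n (\<lambda>j. w (Suc j)) (\<lambda>j. a (Suc j))"
  have dot: "vec_dot n (\<lambda>i. poly_at \<alpha> (a i)) (\<lambda>i. exp_at \<alpha> (w i)) = fps_to_fls L"
    by (simp add: vec_dot_def L_def poly_at_conv_taylor exp_at_conv_fps_exp fls_times_fps_to_fls
        fps_to_fls_sum sum.atLeast1_atMost_eq)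
  \<comment> \<open>An index attaining the maximum has minimal order; its factor in the product
    cancels the inverse norm.\<close>
  have "vec_norm n (\<lambda>i. poly_at \<alpha> (a i)) \<in> (\<lambda>i. fls_abs (poly_at \<alpha> (a i))) ` {1..n}"
    unfolding vec_norm_def using assms(1) by (intro Max_in) auto
  then obtain i where i: "i \<in> {1..n}" "vec_norm n (\<lambda>i. poly_at \<alpha> (a i)) = fls_abs (poly_at \<alpha> (a i))"
    by blast
  \<comment> \<open>Vectors are indexed from 1, matrix columns from 0.\<close>
  define k where "k = i - 1"
  have k: "k < n" "i = Suc k" using i(1) by (auto simp: k_def)
  have "(\<Prod>i=1..n. fls_abs (poly_at \<alpha> (a i))) = (\<Prod>j<n. fls_abs (poly_at \<alpha> (a (Suc j))))"
    by (simp add: prod.atLeast1_atMost_eq)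
  also have "\<dots> = fls_abs (poly_at \<alpha> (a i)) * (\<Prod>j\<in>{..<n} - {k}. fls_abs (poly_at \<alpha> (a (Suc j))))"
    unfolding k(2) using k(1) by (intro prod.remove) auto
  also have "(\<Prod>j\<in>{..<n} - {k}. fls_abs (poly_at \<alpha> (a (Suc j))))
      = exp (- real (\<Sum>j\<in>{..<n} - {k}. order \<alpha> (a (Suc j))))"
    using nz by (simp add: fls_abs_poly_at exp_sum flip: sum_negf)
  finally have prod: "inverse (vec_norm n (\<lambda>i. poly_at \<alpha> (a i))) * (\<Prod>i=1..n. fls_abs (poly_at \<alpha> (a i)))
      = exp (- real (\<Sum>j\<in>{..<n} - {k}. order \<alpha> (a (Suc j))))"
    using i nz by (simp add: fls_abs_poly_at)
  have inj': "inj_on (\<lambda>j. w (Suc j)) {..<n}"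
    by (rule inj_on_Suc_shift[OF inj])
  have nz': "a (Suc j) \<noteq> 0" if "j < n" for j using nz that by simp
  have L: "L \<noteq> 0"
    and le: "(\<Sum>j\<in>{..<n} - {k}. order \<alpha> (a (Suc j))) + subdegree L \<le> order \<alpha> D + (\<Sum>i<n. i)"
    unfolding L_def D_def
    using order_exp_wronskian_ge[of "\<lambda>j. w (Suc j)" n "\<lambda>j. a (Suc j)"
        "\<lambda>j. exp (w (Suc j) * \<alpha>)" k \<alpha>, OF inj' nz' _ k(1)] by simp_all
  \<comment> \<open>The loss from differentiating in rows 0 to n - 1 is exactly the exponent of
    \<open>C_const n\<close>.\<close>
  have gauss: "real (\<Sum>i<n. i) = real n * (real n - 1) / 2"
    by (induction n) (simp_all add: field_simps)
  have "exp (- real (order \<alpha> D)) * inverse (C_const n) = exp (- (real (order \<alpha> D) + real (\<Sum>i<n. i)))"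
    unfolding C_const_def gauss minus_add_distrib exp_add exp_minus ..
  also have "\<dots> \<le> exp (- (real (\<Sum>j\<in>{..<n} - {k}. order \<alpha> (a (Suc j))) + real (subdegree L)))"
    using le by (simp del: of_nat_sum flip: of_nat_add)
  also have "\<dots> = exp (- real (\<Sum>j\<in>{..<n} - {k}. order \<alpha> (a (Suc j)))) * fls_abs (fps_to_fls L)"
    by (simp add: fls_abs_fps_to_fls[OF L] flip: exp_add)
  finally show ?thesis
    unfolding D_def prod dot .
qed

theorem theorem6p1:
  fixes n s :: nat
    and \<omega> :: "nat \<Rightarrow> complex"
    and S :: "complex set"
    and a :: "nat \<Rightarrow> complex poly"
  assumes "n \<ge> 1"
    and "inj_on \<omega> {1..n}"
    and "finite S"
    and "card S = s"
    and "s \<ge> 1"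
    and "\<And>i. i \<in> {1..n} \<Longrightarrow> a i \<noteq> 0"
  shows "(\<Prod>i=1..n. poly_abs_infty (a i)) *
         (\<Prod>\<alpha>\<in>S. inverse (vec_norm n (\<lambda>i. poly_at \<alpha> (a i))) *
                (\<Prod>i=1..n. fls_abs (poly_at \<alpha> (a i))) *
                fls_abs (vec_dot n (\<lambda>i. poly_at \<alpha> (a i)) (\<lambda>i. exp_at \<alpha> (\<omega> i))))
         \<ge> inverse (C_const n) ^ s"
proof -
  \<comment> \<open>\<open>D\<close> does not depend on \<alpha>, so one polynomial controls the
    local factors at all points of \<open>S\<close>.\<close>
  define D where "D = exp_wronskian n (\<lambda>j. \<omega> (Suc j)) (\<lambda>j. a (Suc j))"
  have D: "D \<noteq> 0" "degree D = (\<Sum>j<n. degree (a (Suc j)))"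
    unfolding D_def
    by (rule degree_exp_wronskian[OF inj_on_Suc_shift[OF assms(2)]], simp add: assms(6))+
  have infty: "(\<Prod>i=1..n. poly_abs_infty (a i)) = exp (real (degree D))"
    using assms(6) by (simp add: D(2) prod.atLeast1_atMost_eq poly_abs_infty_def exp_sum)
  have Cpos: "C_const n > 0" by (simp add: C_const_def)
  \<comment> \<open>Points of \<open>S\<close> that are not roots have order 0, and the orders at
    all roots add up to at most the degree.\<close>
  have "(\<Sum>\<alpha>\<in>S. order \<alpha> D) \<le> (\<Sum>\<alpha>\<in>S \<inter> {\<alpha>. poly D \<alpha> = 0}. order \<alpha> D)"
    using assms(3) by (intro eq_refl[OF sum.mono_neutral_right]) (use order_root[of D] in auto)
  also have "\<dots> \<le> (\<Sum>\<alpha> | poly D \<alpha> = 0. order \<alpha> D)"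
    using poly_roots_finite[OF D(1)] by (intro sum_mono2) auto
  also have "\<dots> \<le> degree D" by (rule sum_order_le_degree[OF D(1)])
  finally have "real (\<Sum>\<alpha>\<in>S. order \<alpha> D) \<le> real (degree D)"
    by (rule of_nat_mono)
  then have "1 \<le> exp (real (degree D) - real (\<Sum>\<alpha>\<in>S. order \<alpha> D))"
    by (simp only: one_le_exp_iff diff_ge_0_iff_ge)
  then have "1 * inverse (C_const n) ^ s
      \<le> exp (real (degree D) - real (\<Sum>\<alpha>\<in>S. order \<alpha> D)) * inverse (C_const n) ^ s"
    by (rule mult_right_mono) (use Cpos in simp)
  also have "exp (real (degree D) - real (\<Sum>\<alpha>\<in>S. order \<alpha> D))
      = exp (real (degree D)) * (\<Prod>\<alpha>\<in>S. exp (- real (order \<alpha> D)))"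
    unfolding diff_conv_add_uminus exp_add of_nat_sum sum_negf[symmetric] exp_sum[OF assms(3)] ..
  \<comment> \<open>Each of the \<open>s\<close> points receives one factor
    \<open>inverse (C_const n)\<close>, matching the local estimate.\<close>
  also have "\<dots> * inverse (C_const n) ^ s
      = exp (real (degree D)) * (\<Prod>\<alpha>\<in>S. exp (- real (order \<alpha> D)) * inverse (C_const n))"
    using assms(4) by (simp only: prod.distrib prod_constant mult.assoc)
  also have "\<dots> \<le> exp (real (degree D)) *
      (\<Prod>\<alpha>\<in>S. inverse (vec_norm n (\<lambda>i. poly_at \<alpha> (a i))) *
                (\<Prod>i=1..n. fls_abs (poly_at \<alpha> (a i))) *
                fls_abs (vec_dot n (\<lambda>i. poly_at \<alpha> (a i)) (\<lambda>i. exp_at \<alpha> (\<omega> i))))"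
    unfolding D_def using Cpos
    by (intro mult_left_mono prod_mono conjI local_factor_ge assms(1,2,6)) auto
  finally show ?thesis by (simp only: infty mult_1_left)
qed

end
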